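(* Let $n\ge 2$ be an integer with prime decomposition $n = p_1^{y_1}\cdots p_r^{y_r}$ (the $p_i$ pairwise distinct primes, $y_i>0$), let $m=\gcd(p_1^{y_1}-1,\dots,p_r^{y_r}-1)$ and let $c\ge 1$. Then $\Gamma_{n,c}\simeq G_{n,c}$.
   Context: The group $\Gamma_n$ is $$\Gamma_n=\left\langle a,t_1,\dots,t_r \ \middle|\ t_it_j=t_jt_i\ (i\neq j),\ t_i a t_i^{-1}=a^{p_i^{y_i}}\ (1\le i\le r)\right\rangle.$$ The lower central series of a group $G$ is $\gamma_1(G)=G$, $\gamma_{k+1}(G)=[\gamma_k(G),G]$. For $c\ge 1$, $\Gamma_{n,c}=\Gamma_n/\gamma_{c+1}(\Gamma_n)$. Write $\mathbb{Z}_{m^c}=\langle x \mid x^{m^c}=1\rangle$ for the cyclic group of order $m^c$ and $\mathbb{Z}^r=\langle s_1,\dots,s_r\mid s_is_j=s_js_i\rangle$. The group $G_{n,c}$ is the semidirect product $$G_{n,c}=\mathbb{Z}_{m^c}\rtimes \mathbb{Z}^r,$$ where the action of $\mathbb{Z}^r$ on $\mathbb{Z}_{m^c}$ is given by $s_i x s_i^{-1}=x^{p_i^{y_i}}$ for $1\le i\le r$ (well defined since $\gcd(p_i^{y_i},m)=1$). *)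

theory Defs
  imports "HOL-Algebra.Algebra" "HOL-Number_Theory.Number_Theory"
begin

section \<open>Groups given by generators and relations\<close>

text \<open>A letter \<open>(x, True)\<close> stands for the generator \<open>x\<close> and \<open>(x, False)\<close> for its formal inverse.\<close>

type_synonym 'g word = "('g \<times> bool) list"

definition words :: "'g set \<Rightarrow> 'g word set"
  where "words S = lists (S \<times> UNIV)"

text \<open>
  A relation \<open>l = r\<close> is a pair \<open>(l, r)\<close> of words over \<open>S\<close>. Two words represent the same element
  of \<open>\<langle>S | R\<rangle>\<close> iff one is obtained from the other by finitely many insertions and deletions of
  factors \<open>x x\<^sup>-\<^sup>1\<close>, \<open>x\<^sup>-\<^sup>1 x\<close> and replacements of one side of a relation by the other.
\<close>

inductive pres_eq :: "'g set \<Rightarrow> ('g word \<times> 'g word) set \<Rightarrow> 'g word \<Rightarrow> 'g word \<Rightarrow> bool"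
  for S R where
  refl: "w \<in> words S \<Longrightarrow> pres_eq S R w w"
| sym: "pres_eq S R u v \<Longrightarrow> pres_eq S R v u"
| trans: "pres_eq S R u v \<Longrightarrow> pres_eq S R v w \<Longrightarrow> pres_eq S R u w"
| cancel: "u \<in> words S \<Longrightarrow> v \<in> words S \<Longrightarrow> x \<in> S \<Longrightarrow>
    pres_eq S R (u @ [(x, b), (x, \<not> b)] @ v) (u @ v)"
| relation: "u \<in> words S \<Longrightarrow> v \<in> words S \<Longrightarrow> (l, r) \<in> R \<Longrightarrow> l \<in> words S \<Longrightarrow> r \<in> words S \<Longrightarrow>
    pres_eq S R (u @ l @ v) (u @ r @ v)"

definition pres_rel :: "'g set \<Rightarrow> ('g word \<times> 'g word) set \<Rightarrow> 'g word rel"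
  where "pres_rel S R = {(u, v). pres_eq S R u v}"

definition presented_group :: "'g set \<Rightarrow> ('g word \<times> 'g word) set \<Rightarrow> 'g word set monoid"
  where "presented_group S R =
    \<lparr>carrier = words S // pres_rel S R,
     monoid.mult = \<lambda>C D. \<Union>u\<in>C. \<Union>v\<in>D. pres_rel S R `` {u @ v},
     one = pres_rel S R `` {[]}\<rparr>"

lemma append_in_words [simp]: "u @ v \<in> words S \<longleftrightarrow> u \<in> words S \<and> v \<in> words S"
  by (auto simp: words_def)

lemma Nil_in_words [simp]: "[] \<in> words S"
  by (simp add: words_def)

lemma Cons_in_words [simp]: "(x, b) # w \<in> words S \<longleftrightarrow> x \<in> S \<and> w \<in> words S"
  by (auto simp: words_def)

lemma pres_eq_words: "pres_eq S R u v \<Longrightarrow> u \<in> words S \<and> v \<in> words S"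
  by (induction rule: pres_eq.induct) auto

lemma equiv_pres_rel: "equiv (words S) (pres_rel S R)"
  by (rule equivI)
    (auto simp: pres_rel_def refl_on_def sym_def trans_def dest: pres_eq_words
      intro: pres_eq.intros(1-3))

lemma pres_eq_ctxt:
  "pres_eq S R u v \<Longrightarrow> a \<in> words S \<Longrightarrow> b \<in> words S \<Longrightarrow> pres_eq S R (a @ u @ b) (a @ v @ b)"
proof (induction rule: pres_eq.induct)
  case (cancel u v x c)
  then show ?case
    using pres_eq.cancel[of "a @ u" S "v @ b" x R c] by simp
next
  case (relation u v l r)
  then show ?case
    using pres_eq.relation[of "a @ u" S "v @ b" l r R] by simp
qed (auto intro: pres_eq.refl pres_eq.sym pres_eq.trans)

lemma pres_eq_append:
  assumes "pres_eq S R u u'" "pres_eq S R v v'"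
  shows "pres_eq S R (u @ v) (u' @ v')"
  using pres_eq_ctxt[OF assms(1), of "[]" v] pres_eq_ctxt[OF assms(2), of u' "[]"]
    pres_eq_words[OF assms(1)] pres_eq_words[OF assms(2)]
  by (auto intro: pres_eq.trans)

lemma pres_class_mult:
  assumes "u \<in> words S" "v \<in> words S"
  shows "pres_rel S R `` {u} \<otimes>\<^bsub>presented_group S R\<^esub> pres_rel S R `` {v} = pres_rel S R `` {u @ v}"
proof -
  have "congruent2 (pres_rel S R) (pres_rel S R) (\<lambda>u v. pres_rel S R `` {u @ v})"
  proof (rule congruent2I')
    fix u u' v v' assume "(u, u') \<in> pres_rel S R" "(v, v') \<in> pres_rel S R"
    then have "(u @ v, u' @ v') \<in> pres_rel S R"
      by (simp add: pres_rel_def pres_eq_append)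
    then show "pres_rel S R `` {u @ v} = pres_rel S R `` {u' @ v'}"
      by (rule equiv_class_eq[OF equiv_pres_rel])
  qed
  then show ?thesis
    using UN_equiv_class2[OF equiv_pres_rel equiv_pres_rel _ assms] by (simp add: presented_group_def)
qed

definition inv_word :: "'g word \<Rightarrow> 'g word"
  where "inv_word w = rev (map (\<lambda>(x, b). (x, \<not> b)) w)"

lemma inv_word_left: "w \<in> words S \<Longrightarrow> inv_word w \<in> words S \<and> pres_eq S R (inv_word w @ w) []"
proof (induction w)
  case Nil
  show ?case by (simp add: inv_word_def pres_eq.refl)
next
  case (Cons l w)
  obtain x b where l: "l = (x, b)" by fastforce
  have eq: "inv_word (l # w) = inv_word w @ [(x, \<not> b)]"
    by (simp add: inv_word_def l)
  have "pres_eq S R (inv_word w @ [(x, \<not> b), (x, \<not> \<not> b)] @ w) (inv_word w @ w)"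
    using Cons l by (intro pres_eq.cancel) auto
  then show ?case
    using Cons l eq by (auto intro: pres_eq.trans)
qed

lemma group_presented_group: "group (presented_group S R)"
proof (rule groupI)
  let ?G = "presented_group S R" and ?c = "\<lambda>w. pres_rel S R `` {w}"
  have car: "carrier ?G = ?c ` words S"
    by (auto simp: presented_group_def quotient_def)
  have one: "\<one>\<^bsub>?G\<^esub> = ?c []"
    by (simp add: presented_group_def)
  show "\<one>\<^bsub>?G\<^esub> \<in> carrier ?G"
    by (simp add: car one)
  show "C \<otimes>\<^bsub>?G\<^esub> D \<in> carrier ?G" if "C \<in> carrier ?G" "D \<in> carrier ?G" for C D
    using that by (auto simp: car pres_class_mult)
  show "C \<otimes>\<^bsub>?G\<^esub> D \<otimes>\<^bsub>?G\<^esub> E = C \<otimes>\<^bsub>?G\<^esub> (D \<otimes>\<^bsub>?G\<^esub> E)"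
    if "C \<in> carrier ?G" "D \<in> carrier ?G" "E \<in> carrier ?G" for C D E
    using that by (auto simp: car pres_class_mult)
  show "\<one>\<^bsub>?G\<^esub> \<otimes>\<^bsub>?G\<^esub> C = C" if "C \<in> carrier ?G" for C
    using that by (auto simp: car one pres_class_mult)
  show "\<exists>D\<in>carrier ?G. D \<otimes>\<^bsub>?G\<^esub> C = \<one>\<^bsub>?G\<^esub>" if "C \<in> carrier ?G" for C
  proof -
    obtain w where w: "w \<in> words S" "C = ?c w" using \<open>C \<in> carrier ?G\<close> car by auto
    have "?c (inv_word w @ w) = ?c []"
      using inv_word_left[OF w(1), of R]
      by (intro equiv_class_eq[OF equiv_pres_rel]) (simp add: pres_rel_def)
    then show ?thesis
      using w inv_word_left[OF w(1), of R] by (auto simp: car one pres_class_mult)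
  qed
qed


section \<open>The group \<open>\<Gamma>\<^sub>n\<close> and its nilpotent quotients\<close>

datatype gen = Gen_a | Gen_t nat

definition Gamma :: "nat \<Rightarrow> (nat \<Rightarrow> nat) \<Rightarrow> (nat \<Rightarrow> nat) \<Rightarrow> gen word set monoid"
  where "Gamma r p y = presented_group
    ({Gen_a} \<union> Gen_t ` {1..r})
    ({([(Gen_t i, True), (Gen_t j, True)], [(Gen_t j, True), (Gen_t i, True)]) | i j.
        i \<in> {1..r} \<and> j \<in> {1..r} \<and> i \<noteq> j} \<union>
     {([(Gen_t i, True), (Gen_a, True), (Gen_t i, False)], replicate (p i ^ y i) (Gen_a, True)) | i.
        i \<in> {1..r}})"

definition commutator_subgroup :: "('a, 'b) monoid_scheme \<Rightarrow> 'a set \<Rightarrow> 'a set \<Rightarrow> 'a set"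
  where "commutator_subgroup G H K = generate G
    {h \<otimes>\<^bsub>G\<^esub> k \<otimes>\<^bsub>G\<^esub> inv\<^bsub>G\<^esub> h \<otimes>\<^bsub>G\<^esub> inv\<^bsub>G\<^esub> k | h k. h \<in> H \<and> k \<in> K}"

text \<open>The series is indexed from \<open>1\<close>; the value at \<open>0\<close> is a dummy.\<close>

fun lower_central :: "('a, 'b) monoid_scheme \<Rightarrow> nat \<Rightarrow> 'a set" where
  "lower_central G 0 = carrier G"
| "lower_central G (Suc 0) = carrier G"
| "lower_central G (Suc (Suc k)) =
    commutator_subgroup G (lower_central G (Suc k)) (carrier G)"

lemma (in group) normal_commutator_subgroup:
  assumes H: "H \<lhd> G"
  shows "commutator_subgroup G H (carrier G) \<lhd> G"
  unfolding commutator_subgroup_def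
proof (rule normal_generateI)
  have Hc: "h \<in> carrier G" if "h \<in> H" for h
    by (rule subgroup.mem_carrier[OF normal_imp_subgroup[OF H] that])
  show "{h \<otimes> k \<otimes> inv h \<otimes> inv k | h k. h \<in> H \<and> k \<in> carrier G} \<subseteq> carrier G"
    using Hc by auto
  fix u g assume "u \<in> {h \<otimes> k \<otimes> inv h \<otimes> inv k | h k. h \<in> H \<and> k \<in> carrier G}" and g: "g \<in> carrier G"
  then obtain h k where u: "u = h \<otimes> k \<otimes> inv h \<otimes> inv k" and h: "h \<in> H" and k: "k \<in> carrier G"
    by blast
  have conj: "g \<otimes> h \<otimes> inv g \<in> H" "g \<otimes> k \<otimes> inv g \<in> carrier G"
    using normal.inv_op_closed2[OF H g h] g k by auto
  have canc: "inv g \<otimes> (g \<otimes> x) = x" if "x \<in> carrier G" for x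
    using g that by (simp flip: m_assoc)
  have "g \<otimes> u \<otimes> inv g = (g \<otimes> h \<otimes> inv g) \<otimes> (g \<otimes> k \<otimes> inv g) \<otimes> inv (g \<otimes> h \<otimes> inv g)
      \<otimes> inv (g \<otimes> k \<otimes> inv g)"
    using g k Hc[OF h] by (simp add: u m_assoc inv_mult_group canc)
  then show "g \<otimes> u \<otimes> inv g \<in> {h \<otimes> k \<otimes> inv h \<otimes> inv k | h k. h \<in> H \<and> k \<in> carrier G}"
    using conj by blast
qed

lemma (in group) normal_lower_central: "lower_central G k \<lhd> G"
proof (induction k)
  case (Suc k)
  then show ?case
    by (cases k) (simp_all add: normal_commutator_subgroup normal_self)
qed (simp add: normal_self)

definition Gamma_nilp :: "nat \<Rightarrow> (nat \<Rightarrow> nat) \<Rightarrow> (nat \<Rightarrow> nat) \<Rightarrow> nat \<Rightarrow> gen word set set monoid"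
  where "Gamma_nilp r p y c = Gamma r p y Mod lower_central (Gamma r p y) (c + 1)"


section \<open>The group \<open>G\<^sub>n\<^sub>,\<^sub>c\<close>\<close>

text \<open>
  For \<open>\<phi> : H \<rightarrow> Aut N\<close> the multiplication is chosen such that \<open>h x h\<^sup>-\<^sup>1 = \<phi> h x\<close>
  for \<open>h \<in> H\<close> and \<open>x \<in> N\<close>.
\<close>

definition semidirect_product ::
  "('a, 'b) monoid_scheme \<Rightarrow> ('h, 'd) monoid_scheme \<Rightarrow> ('h \<Rightarrow> 'a \<Rightarrow> 'a) \<Rightarrow> ('a \<times> 'h) monoid"
  where "semidirect_product N H \<phi> =
    \<lparr>carrier = carrier N \<times> carrier H,
     monoid.mult = \<lambda>(x, h) (x', h'). (x \<otimes>\<^bsub>N\<^esub> \<phi> h x', h \<otimes>\<^bsub>H\<^esub> h'),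
     one = (\<one>\<^bsub>N\<^esub>, \<one>\<^bsub>H\<^esub>)\<rparr>"

definition power_map :: "nat \<Rightarrow> nat \<Rightarrow> int \<Rightarrow> int"
  where "power_map k q =
    (\<lambda>x \<in> carrier (integer_mod_group k). x [^]\<^bsub>integer_mod_group k\<^esub> q)"

text \<open>
  \<open>\<int>\<^sup>r\<close> is the free Abelian group on \<open>{1..r}\<close>, whose generator \<open>s\<^sub>i\<close> is \<open>frag_of i\<close>. An element
  \<open>v = \<Sum>\<^sub>i v\<^sub>i s\<^sub>i\<close> acts on the cyclic group of order \<open>k\<close> as \<open>\<Prod>\<^sub>i \<alpha>\<^sub>i [^] v\<^sub>i\<close>, computed in the
  automorphism group, where \<open>\<alpha>\<^sub>i\<close> is the map \<open>x \<mapsto> x [^] q i\<close>. The lemmas below show that this is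
  a well-defined action whenever all \<open>q i\<close> are coprime to \<open>k\<close>.
\<close>

definition power_action :: "nat \<Rightarrow> nat \<Rightarrow> (nat \<Rightarrow> nat) \<Rightarrow> (nat \<Rightarrow>\<^sub>0 int) \<Rightarrow> int \<Rightarrow> int"
  where "power_action k r q v =
    finprod (AutoGroup (integer_mod_group k))
      (\<lambda>i. power_map k (q i) [^]\<^bsub>AutoGroup (integer_mod_group k)\<^esub> Poly_Mapping.lookup v i) {1..r}"

definition G_nilp ::
  "nat \<Rightarrow> (nat \<Rightarrow> nat) \<Rightarrow> (nat \<Rightarrow> nat) \<Rightarrow> nat \<Rightarrow> nat \<Rightarrow> (int \<times> (nat \<Rightarrow>\<^sub>0 int)) monoid"
  where "G_nilp r p y m c =
    semidirect_product (integer_mod_group (m ^ c)) (free_Abelian_group {1..r})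
      (power_action (m ^ c) r (\<lambda>i. p i ^ y i))"

lemma carrier_AutoGroup: "carrier (AutoGroup G) = auto G"
  by (simp add: AutoGroup_def)

lemma AutoGroup_mult_apply:
  assumes "f \<in> auto G" "g \<in> auto G" "x \<in> carrier G"
  shows "(f \<otimes>\<^bsub>AutoGroup G\<^esub> g) x = f (g x)"
  using assms by (simp add: AutoGroup_def BijGroup_def auto_def compose_eq)

lemma AutoGroup_one_apply: "x \<in> carrier G \<Longrightarrow> \<one>\<^bsub>AutoGroup G\<^esub> x = x"
  by (simp add: AutoGroup_def BijGroup_def)

lemma auto_extensional: "f \<in> auto G \<Longrightarrow> f \<in> extensional (carrier G)"
  by (simp add: auto_def Bij_def)

lemma auto_closed: "f \<in> auto G \<Longrightarrow> x \<in> carrier G \<Longrightarrow> f x \<in> carrier G"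
  by (auto simp: auto_def hom_def)

lemma auto_mult:
  "f \<in> auto G \<Longrightarrow> x \<in> carrier G \<Longrightarrow> y \<in> carrier G \<Longrightarrow> f (x \<otimes>\<^bsub>G\<^esub> y) = f x \<otimes>\<^bsub>G\<^esub> f y"
  by (auto simp: auto_def hom_def)

lemma auto_integer_mod_group_apply:
  assumes f: "f \<in> auto (integer_mod_group k)" and k: "k > 1" and x: "x \<in> carrier (integer_mod_group k)"
  shows "f x = (x * f 1) mod int k"
proof -
  let ?Z = "integer_mod_group k"
  have 1: "1 \<in> carrier ?Z" using k by simp
  interpret group_hom ?Z ?Z f
    using f by (simp add: group_hom_def group_hom_axioms_def auto_def)
  have "0 \<le> x" "x < int k" using x k by (auto simp: carrier_integer_mod_group)
  then have "x = 1 [^]\<^bsub>?Z\<^esub> x" by (simp add: int_pow_integer_mod_group)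
  then have "f x = f 1 [^]\<^bsub>?Z\<^esub> x"
    using hom_int_pow[OF 1] by metis
  then show ?thesis by (simp add: int_pow_integer_mod_group)
qed

lemma comm_group_AutoGroup_integer_mod_group:
  assumes k: "k > 0"
  shows "comm_group (AutoGroup (integer_mod_group k))"
proof -
  let ?Z = "integer_mod_group k" and ?A = "AutoGroup (integer_mod_group k)"
  interpret A: group ?A by (rule group.AutoGroup) simp
  show ?thesis
  proof (rule A.group_comm_groupI)
    fix f g assume "f \<in> carrier ?A" "g \<in> carrier ?A"
    then have fg: "f \<in> auto ?Z" "g \<in> auto ?Z" by (simp_all add: carrier_AutoGroup)
    have m: "f \<otimes>\<^bsub>?A\<^esub> g \<in> auto ?Z" "g \<otimes>\<^bsub>?A\<^esub> f \<in> auto ?Z"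
      using fg A.m_closed by (simp_all add: carrier_AutoGroup)
    show "f \<otimes>\<^bsub>?A\<^esub> g = g \<otimes>\<^bsub>?A\<^esub> f"
    proof (rule extensionalityI[OF m[THEN auto_extensional]])
      fix x assume x: "x \<in> carrier ?Z"
      have "f (g x) = g (f x)"
      proof (cases "k = 1")
        case True
        then have "carrier ?Z = {0}" by (auto simp: carrier_integer_mod_group)
        then show ?thesis
          using auto_closed[OF fg(1)] auto_closed[OF fg(2)] x by auto
      next
        case False
        then have k: "k > 1" using k by simp
        have "f (g x) = (x * g 1 * f 1) mod int k" "g (f x) = (x * f 1 * g 1) mod int k"
          using fg[THEN auto_closed, OF x] x fg
          by (simp_all only: auto_integer_mod_group_apply[OF _ k] mod_mult_left_eq)
        then show ?thesis by (simp only: mult.assoc mult.commute[of "f 1"])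
      qed
      then show "(f \<otimes>\<^bsub>?A\<^esub> g) x = (g \<otimes>\<^bsub>?A\<^esub> f) x"
        using fg x by (simp add: AutoGroup_mult_apply)
    qed
  qed
qed

lemma power_map_auto:
  assumes k: "k > 0" and q: "coprime q k"
  shows "power_map k q \<in> auto (integer_mod_group k)"
proof -
  let ?Z = "integer_mod_group k"
  have car: "carrier ?Z = {0..<int k}" using k by (simp add: carrier_integer_mod_group)
  have hom: "power_map k q \<in> hom ?Z ?Z"
    using k by (auto simp: power_map_def hom_def car distrib_left mod_add_eq mod_mult_right_eq)
  have inj: "inj_on (power_map k q) (carrier ?Z)"
  proof (rule inj_onI)
    fix x z assume xz: "x \<in> carrier ?Z" "z \<in> carrier ?Z" "power_map k q x = power_map k q z"
    then have "[int q * x = int q * z] (mod int k)"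
      by (simp add: power_map_def cong_def)
    then have "[x = z] (mod int k)"
      using q by (simp add: cong_mult_lcancel)
    then show "x = z" using xz(1,2) by (simp add: car cong_def)
  qed
  have "power_map k q ` carrier ?Z \<subseteq> carrier ?Z"
    using hom by (auto simp: hom_def)
  then have "bij_betw (power_map k q) (carrier ?Z) (carrier ?Z)"
    using inj by (simp add: bij_betw_def endo_inj_surj car)
  then show ?thesis
    using hom by (simp add: auto_def Bij_def power_map_def)
qed

lemma power_action_hom:
  assumes k: "k > 0" and q: "\<And>i. i \<in> {1..r} \<Longrightarrow> coprime (q i) k"
  shows "power_action k r q \<in> hom (free_Abelian_group {1..r}) (AutoGroup (integer_mod_group k))"
proof -
  let ?A = "AutoGroup (integer_mod_group k)"
  interpret A: comm_group ?A by (rule comm_group_AutoGroup_integer_mod_group[OF k])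
  have c: "power_map k (q i) \<in> carrier ?A" if "i \<in> {1..r}" for i
    using power_map_auto[OF k q[OF that]] by (simp add: carrier_AutoGroup)
  show ?thesis
  proof (rule homI)
    show "power_action k r q v \<in> carrier ?A" for v
      unfolding power_action_def by (intro A.finprod_closed) (auto intro!: A.int_pow_closed c)
    fix v w
    have "power_action k r q (v + w) = finprod ?A
      (\<lambda>i. (power_map k (q i) [^]\<^bsub>?A\<^esub> Poly_Mapping.lookup v i) \<otimes>\<^bsub>?A\<^esub>
           (power_map k (q i) [^]\<^bsub>?A\<^esub> Poly_Mapping.lookup w i)) {1..r}"
      unfolding power_action_def
      by (intro A.finprod_cong') (auto simp: Poly_Mapping.lookup_add A.int_pow_mult c)
    also have "\<dots> = power_action k r q v \<otimes>\<^bsub>?A\<^esub> power_action k r q w"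
      unfolding power_action_def
      by (intro A.finprod_multf) (auto intro!: A.int_pow_closed c)
    finally show "power_action k r q (v \<otimes>\<^bsub>free_Abelian_group {1..r}\<^esub> w) =
        power_action k r q v \<otimes>\<^bsub>?A\<^esub> power_action k r q w"
      by simp
  qed
qed

lemma power_action_generator:
  assumes k: "k > 0" and q: "\<And>i. i \<in> {1..r} \<Longrightarrow> coprime (q i) k" and i: "i \<in> {1..r}"
    and x: "x \<in> carrier (integer_mod_group k)"
  shows "power_action k r q (frag_of i) x = x [^]\<^bsub>integer_mod_group k\<^esub> q i"
proof -
  let ?A = "AutoGroup (integer_mod_group k)"
  interpret A: comm_group ?A by (rule comm_group_AutoGroup_integer_mod_group[OF k])
  have c: "power_map k (q j) \<in> carrier ?A" if "j \<in> {1..r}" for j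
    using power_map_auto[OF k q[OF that]] by (simp add: carrier_AutoGroup)
  have "power_action k r q (frag_of i) =
      finprod ?A (\<lambda>j. if i = j then power_map k (q j) else \<one>\<^bsub>?A\<^esub>) {1..r}"
    unfolding power_action_def
    by (intro A.finprod_cong') (auto simp: c)
  also have "\<dots> = power_map k (q i)"
    using i c by (intro A.finprod_singleton) auto
  finally show ?thesis using x by (simp add: power_map_def)
qed

lemma group_semidirect_product:
  assumes N: "group N" and H: "group H" and \<phi>: "\<phi> \<in> hom H (AutoGroup N)"
  shows "group (semidirect_product N H \<phi>)"
proof -
  interpret N: group N by (rule N)
  interpret H: group H by (rule H)
  interpret \<phi>: group_hom H "AutoGroup N" \<phi>
    by (intro group_hom.intro group_hom_axioms.intro H N.AutoGroup \<phi>)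
  have a: "\<phi> h \<in> auto N" if "h \<in> carrier H" for h
    using \<phi>.hom_closed[OF that] by (simp add: carrier_AutoGroup)
  have app: "\<phi> (h \<otimes>\<^bsub>H\<^esub> h') x = \<phi> h (\<phi> h' x)"
    if "h \<in> carrier H" "h' \<in> carrier H" "x \<in> carrier N" for h h' x
    using that by (simp add: \<phi>.hom_mult AutoGroup_mult_apply a)
  have app1: "\<phi> \<one>\<^bsub>H\<^esub> x = x" if "x \<in> carrier N" for x
    using that by (simp add: AutoGroup_one_apply)
  show ?thesis
  proof (rule groupI)
    let ?P = "semidirect_product N H \<phi>"
    fix u assume "u \<in> carrier ?P"
    then obtain x h where u: "u = (x, h)" "x \<in> carrier N" "h \<in> carrier H"
      by (auto simp: semidirect_product_def)
    have h': "inv\<^bsub>H\<^esub> h \<in> carrier H" using u by simp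
    have "inv\<^bsub>N\<^esub> (\<phi> (inv\<^bsub>H\<^esub> h) x) \<in> carrier N" "\<phi> (inv\<^bsub>H\<^esub> h) x \<in> carrier N"
      using u h' auto_closed[OF a[OF h']] by auto
    then show "\<exists>v\<in>carrier ?P. v \<otimes>\<^bsub>?P\<^esub> u = \<one>\<^bsub>?P\<^esub>"
      using u h'
      by (intro bexI[of _ "(inv\<^bsub>N\<^esub> (\<phi> (inv\<^bsub>H\<^esub> h) x), inv\<^bsub>H\<^esub> h)"]) (auto simp: semidirect_product_def)
  qed (auto simp: semidirect_product_def a auto_closed auto_mult app app1 AutoGroup_mult_apply
      AutoGroup_one_apply N.m_assoc H.m_assoc)
qed

end

theory Submission
  imports Defs
begin

text \<open>
  Write \<open>q\<^sub>i = p\<^sub>i\<^bsup>y\<^sub>i\<^esup>\<close>, \<open>P = \<int>\<^bsub>M\<^esub> \<rtimes> \<int>\<^sup>r\<close> with \<open>M = m\<^sup>c\<close>, and \<open>N = \<gamma>\<^bsub>c+1\<^esub>(\<Gamma>\<^sub>n)\<close>. The elements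
  \<open>x\<close> and \<open>s\<^sub>i\<close> of \<open>P\<close> satisfy the relations of \<open>\<Gamma>\<^sub>n\<close> and generate \<open>P\<close>, so \<open>a \<mapsto> x\<close>, \<open>t\<^sub>i \<mapsto> s\<^sub>i\<close>
  extends to an epimorphism \<open>f : \<Gamma>\<^sub>n \<rightarrow> P\<close>. The theorem says that its kernel is exactly \<open>N\<close>, and each
  inclusion is one property of the number \<open>m\<close>.

  \<open>N \<subseteq> ker f\<close>: since \<open>m\<close> divides every \<open>q\<^sub>i - 1\<close>, every element of \<open>\<int>\<^sup>r\<close> acts on \<open>\<int>\<^bsub>M\<^esub>\<close> as
  multiplication by some \<open>u \<equiv> 1\<close> modulo \<open>m\<close>. A commutator with an element of \<open>m\<^sup>k\<int>\<^bsub>M\<^esub>\<close> therefore gains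
  one more factor \<open>m\<close> (lemma \<open>commutator_central_term\<close>), so that \<open>P\<close> is nilpotent of class at most
  \<open>c\<close>, and homomorphisms map lower central series into central series (\<open>hom_lower_central\<close>).

  \<open>ker f \<subseteq> N\<close>: modulo the next term of the lower central series, \<open>[t\<^sub>i, a\<^sup>e] = a\<^bsup>(q\<^sub>i - 1)e\<^esup>\<close> is trivial
  as soon as \<open>a\<^sup>e\<close> lies in the present one. As \<open>m\<close> is the greatest common divisor of the \<open>q\<^sub>i - 1\<close>,
  this gives \<open>a\<^bsup>m\<^sup>k\<^esup> \<in> \<gamma>\<^bsub>k+1\<^esub>\<close> by induction (\<open>pow_mem_lower_central\<close>), whence \<open>a\<^sup>M \<in> N\<close>. So the cosets
  of \<open>a\<close> and \<open>t\<^sub>i\<close> satisfy the defining relations of \<open>P\<close>, and \<open>x \<mapsto> N a\<close>, \<open>s\<^sub>i \<mapsto> N t\<^sub>i\<close> extends to a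
  homomorphism \<open>\<psi> : P \<rightarrow> \<Gamma>\<^sub>n/N\<close> (\<open>P_universal\<close>). The composite \<open>\<psi> \<circ> f\<close> is the quotient map, because
  it is so on generators; hence \<open>f g = 1\<close> forces \<open>g \<in> N\<close>.
\<close>

section \<open>Homomorphisms and generating sets\<close>

lemma hom_eq_on_generate:
  assumes f: "group_hom G H f" and g: "group_hom G H g" and B: "B \<subseteq> carrier G"
    and eq: "\<And>x. x \<in> B \<Longrightarrow> f x = g x" and u: "u \<in> generate G B"
  shows "f u = g u"
proof -
  interpret f: group_hom G H f by (rule f)
  interpret g: group_hom G H g by (rule g)
  show ?thesis
    using u
  proof (induction rule: generate.induct)
    case (eng u v)
    then show ?case
      using f.G.generate_in_carrier[OF B] by simp
  qed (use B eq in \<open>auto simp: subset_iff\<close>)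
qed

text \<open>
  The elements \<open>u\<close> for which \<open>f (u g) = f u f g\<close> holds for all \<open>g\<close> form a subgroup. This makes it
  possible to check multiplicativity of a map given by a normal form only for left multiplication by
  generators, and not by their inverses.
\<close>

lemma hom_if_mult_generators:
  assumes "group G" "group H" and B: "B \<subseteq> carrier G" "generate G B = carrier G"
    and f: "f \<in> carrier G \<rightarrow> carrier H" "f \<one>\<^bsub>G\<^esub> = \<one>\<^bsub>H\<^esub>"
    and mult: "\<And>x g. x \<in> B \<Longrightarrow> g \<in> carrier G \<Longrightarrow> f (x \<otimes>\<^bsub>G\<^esub> g) = f x \<otimes>\<^bsub>H\<^esub> f g"
  shows "f \<in> hom G H"
proof (rule homI)
  interpret G: group G by (rule assms(1))
  interpret H: group H by (rule assms(2))
  have fc: "f g \<in> carrier H" if "g \<in> carrier G" for g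
    using f that by auto
  show "f g \<in> carrier H" if "g \<in> carrier G" for g
    by (rule fc[OF that])
  fix u g assume u: "u \<in> carrier G" and g: "g \<in> carrier G"
  from u have "u \<in> generate G B" by (simp add: B)
  then show "f (u \<otimes>\<^bsub>G\<^esub> g) = f u \<otimes>\<^bsub>H\<^esub> f g"
    using g
  proof (induction arbitrary: g rule: generate.induct)
    case (inv x)
    then have x: "x \<in> carrier G" using B by auto
    have "f (inv\<^bsub>G\<^esub> x \<otimes>\<^bsub>G\<^esub> h) = inv\<^bsub>H\<^esub> (f x) \<otimes>\<^bsub>H\<^esub> f h" if h: "h \<in> carrier G" for h
    proof -
      have "f x \<otimes>\<^bsub>H\<^esub> f (inv\<^bsub>G\<^esub> x \<otimes>\<^bsub>G\<^esub> h) = f h"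
        using mult[OF inv(1), of "inv\<^bsub>G\<^esub> x \<otimes>\<^bsub>G\<^esub> h"] x h by (simp flip: G.m_assoc)
      then show ?thesis
        using x h fc by (metis G.inv_closed G.m_closed H.inv_solve_left)
    qed
    from this[OF inv(2)] this[OF G.one_closed] show ?case
      using x fc f by simp
  next
    case (eng u v)
    then have "u \<in> carrier G" "v \<in> carrier G"
      using G.generate_in_carrier[OF B(1)] by auto
    with eng show ?case
      using fc G.m_assoc by (simp add: H.m_assoc)
  qed (use f fc B mult in auto)
qed

text \<open>
  The centralizer of any set is a subgroup. So the centralizer of the generators contains all
  that they generate, and then the centralizer of the generated subgroup contains the generators.
\<close>

lemma (in group) comm_group_generate:
  assumes B: "B \<subseteq> carrier G" and comm: "\<And>x y. x \<in> B \<Longrightarrow> y \<in> B \<Longrightarrow> x \<otimes> y = y \<otimes> x"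
  shows "comm_group (G\<lparr>carrier := generate G B\<rparr>)"
proof -
  have swap: "inv x \<otimes> y = y \<otimes> inv x"
    if "x \<in> carrier G" "y \<in> carrier G" "x \<otimes> y = y \<otimes> x" for x y
    using that by (metis inv_closed inv_solve_left inv_solve_right m_assoc m_closed)
  have trans: "(u \<otimes> v) \<otimes> y = y \<otimes> (u \<otimes> v)"
    if "u \<in> carrier G" "v \<in> carrier G" "y \<in> carrier G" "u \<otimes> y = y \<otimes> u" "v \<otimes> y = y \<otimes> v" for u v y
    using that by (metis m_assoc)
  have *: "u \<otimes> y = y \<otimes> u"
    if "u \<in> generate G Z" "Z \<subseteq> carrier G" "y \<in> carrier G" "\<And>z. z \<in> Z \<Longrightarrow> z \<otimes> y = y \<otimes> z" for u y Z
    using that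
  proof (induction rule: generate.induct)
    case (eng u v)
    then show ?case by (intro trans) (auto intro: generate_in_carrier)
  qed (auto intro!: swap)
  note gc = generate_in_carrier[OF B]
  have **: "u \<otimes> y = y \<otimes> u" if "u \<in> generate G B" "y \<in> B" for u y
    using *[OF that(1) B, of y] comm that B by auto
  have "u \<otimes> v = v \<otimes> u" if "u \<in> generate G B" "v \<in> generate G B" for u v
    using *[OF that(1) B, of v] **[OF that(2)] B gc[OF that(2)] by metis
  then show ?thesis
    using subgroup_imp_group[OF generate_is_subgroup[OF B]]
    by (intro group.group_comm_groupI) auto
qed

lemma (in group) conj_int_pow:
  assumes t: "t \<in> carrier G" and a: "a \<in> carrier G" and b: "t \<otimes> a \<otimes> inv t = b"
  shows "t \<otimes> a [^] (x::int) \<otimes> inv t = b [^] x"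
proof -
  let ?g = "\<lambda>z. t \<otimes> z \<otimes> inv t"
  have "?g \<in> hom G G"
  proof (rule homI)
    fix u v assume "u \<in> carrier G" "v \<in> carrier G"
    moreover have "inv t \<otimes> (t \<otimes> w) = w" if "w \<in> carrier G" for w
      using t that by (simp flip: m_assoc)
    ultimately show "?g (u \<otimes> v) = ?g u \<otimes> ?g v"
      using t by (simp add: m_assoc)
  qed (use t in simp)
  then interpret group_hom G G ?g
    by unfold_locales
  show ?thesis
    using hom_int_pow[OF a, of x] b by simp
qed


section \<open>Presented groups\<close>

definition eval_word :: "('a, 'b) monoid_scheme \<Rightarrow> ('g \<Rightarrow> 'a) \<Rightarrow> 'g word \<Rightarrow> 'a"
  where "eval_word H e w =
    foldr (\<lambda>(x, b) g. (if b then e x else inv\<^bsub>H\<^esub> (e x)) \<otimes>\<^bsub>H\<^esub> g) w \<one>\<^bsub>H\<^esub>"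

definition pres_gen :: "'g set \<Rightarrow> ('g word \<times> 'g word) set \<Rightarrow> 'g \<Rightarrow> 'g word set"
  where "pres_gen S R x = pres_rel S R `` {[(x, True)]}"

lemma eval_word_Nil [simp]: "eval_word H e [] = \<one>\<^bsub>H\<^esub>"
  by (simp add: eval_word_def)

lemma eval_word_Cons [simp]:
  "eval_word H e ((x, b) # w) = (if b then e x else inv\<^bsub>H\<^esub> (e x)) \<otimes>\<^bsub>H\<^esub> eval_word H e w"
  by (simp add: eval_word_def)

lemma carrier_presented_group: "carrier (presented_group S R) = (\<lambda>w. pres_rel S R `` {w}) ` words S"
  by (auto simp: presented_group_def quotient_def)

context group
begin

lemma eval_word_closed:
  "e \<in> S \<rightarrow> carrier G \<Longrightarrow> w \<in> words S \<Longrightarrow> eval_word G e w \<in> carrier G"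
  by (induction w) (auto simp: Pi_iff)

lemma eval_word_append:
  assumes "e \<in> S \<rightarrow> carrier G" "u \<in> words S" "v \<in> words S"
  shows "eval_word G e (u @ v) = eval_word G e u \<otimes> eval_word G e v"
  using assms(2)
proof (induction u)
  case (Cons l u)
  then show ?case
    using assms(1,3) by (cases l) (auto simp: m_assoc eval_word_closed Pi_iff)
qed (use assms in \<open>simp add: eval_word_closed\<close>)

lemma eval_word_replicate:
  "x \<in> S \<Longrightarrow> e \<in> S \<rightarrow> carrier G \<Longrightarrow> eval_word G e (replicate k (x, True)) = e x [^] k"
proof (induction k)
  case (Suc k)
  moreover from Suc have "e x \<in> carrier G" by auto
  ultimately show ?case
    using nat_pow_Suc2[of "e x" k] by simp
qed auto

lemma eval_word_pres_eq:
  assumes "pres_eq S R u v" and e: "e \<in> S \<rightarrow> carrier G"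
    and rel: "\<And>l r. (l, r) \<in> R \<Longrightarrow> l \<in> words S \<Longrightarrow> r \<in> words S \<Longrightarrow> eval_word G e l = eval_word G e r"
  shows "eval_word G e u = eval_word G e v"
  using assms(1)
proof (induction rule: pres_eq.induct)
  case (cancel u v x b)
  then have "e x \<in> carrier G" "eval_word G e u \<in> carrier G" "eval_word G e v \<in> carrier G"
    using e eval_word_closed[OF e] by auto
  moreover from this have "e x \<otimes> (inv (e x) \<otimes> eval_word G e v) = eval_word G e v"
      "inv (e x) \<otimes> (e x \<otimes> eval_word G e v) = eval_word G e v"
    by (simp_all flip: m_assoc)
  ultimately show ?case
    using cancel e by (simp add: eval_word_append[of e S])
next
  case (relation u v l r)
  then show ?case
    using e rel by (simp add: eval_word_append[of e S])
qed auto

text \<open>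
  Von Dyck's theorem: evaluation of words is constant on classes, because each elementary
  transformation of words preserves it (\<open>eval_word_pres_eq\<close>).
\<close>

lemma presented_group_universal:
  assumes e: "e \<in> S \<rightarrow> carrier G"
    and rel: "\<And>l r. (l, r) \<in> R \<Longrightarrow> l \<in> words S \<Longrightarrow> r \<in> words S \<Longrightarrow> eval_word G e l = eval_word G e r"
  obtains f where "f \<in> hom (presented_group S R) G" "\<And>x. x \<in> S \<Longrightarrow> f (pres_gen S R x) = e x"
proof -
  define f where "f C = the_elem (eval_word G e ` C)" for C
  let ?c = "\<lambda>w. pres_rel S R `` {w}"
  have f: "f (?c w) = eval_word G e w" if w: "w \<in> words S" for w
  proof -
    have "eval_word G e w' = eval_word G e w" if "w' \<in> ?c w" for w'
      using that by (intro eval_word_pres_eq[OF _ e rel, symmetric]) (simp_all add: pres_rel_def)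
    moreover have "w \<in> ?c w"
      using pres_eq.refl[OF w] by (simp add: pres_rel_def)
    ultimately have "eval_word G e ` ?c w = {eval_word G e w}"
      by blast
    then show ?thesis by (simp add: f_def)
  qed
  show thesis
  proof (rule that[of f])
    show "f \<in> hom (presented_group S R) G"
      by (rule homI) (auto simp: carrier_presented_group f pres_class_mult eval_word_closed[OF e]
          eval_word_append[OF e])
    show "f (pres_gen S R x) = e x" if "x \<in> S" for x
      using f[of "[(x, True)]"] that e by (auto simp: pres_gen_def Pi_iff)
  qed
qed

end

lemma pres_class_eq: "pres_eq S R u v \<Longrightarrow> pres_rel S R `` {u} = pres_rel S R `` {v}"
  by (intro equiv_class_eq[OF equiv_pres_rel]) (simp add: pres_rel_def)

lemma one_presented_group: "\<one>\<^bsub>presented_group S R\<^esub> = pres_rel S R `` {[]}"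
  by (simp add: presented_group_def)

lemma pres_gen_closed: "pres_gen S R \<in> S \<rightarrow> carrier (presented_group S R)"
  by (auto simp: carrier_presented_group pres_gen_def)

text \<open>
  Read in the presented group itself, a word evaluates to its own class. So classes of words can
  be treated as products of generators: generation and validity of the relations both follow.
\<close>

lemma eval_word_pres_gen:
  assumes "w \<in> words S"
  shows "eval_word (presented_group S R) (pres_gen S R) w = pres_rel S R `` {w}"
proof -
  interpret group "presented_group S R" by (rule group_presented_group)
  have inv: "inv\<^bsub>presented_group S R\<^esub> (pres_gen S R x) = pres_rel S R `` {[(x, False)]}" if "x \<in> S" for x
  proof (rule inv_equality)
    have "pres_eq S R [(x, False), (x, True)] []"
      using pres_eq.cancel[of "[]" S "[]" x R False] that by simp
    then show "pres_rel S R `` {[(x, False)]} \<otimes>\<^bsub>presented_group S R\<^esub> pres_gen S R x = \<one>\<^bsub>presented_group S R\<^esub>"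
      using that pres_class_mult[of "[(x, False)]" S "[(x, True)]" R]
      by (simp add: pres_gen_def one_presented_group pres_class_eq)
  qed (use that pres_gen_closed[of S R] in \<open>auto simp: carrier_presented_group\<close>)
  show ?thesis
    using assms
  proof (induction w)
    case Nil
    then show ?case by (simp add: one_presented_group)
  next
    case (Cons l w)
    obtain x b where l: "l = (x, b)" by fastforce
    have "(if b then pres_gen S R x else inv\<^bsub>presented_group S R\<^esub> (pres_gen S R x)) = pres_rel S R `` {[(x, b)]}"
      using Cons l by (simp add: inv) (simp add: pres_gen_def)
    then show ?case
      using Cons l pres_class_mult[of "[(x, b)]" S w R] by simp
  qed
qed

lemma generate_pres_gen:
  "generate (presented_group S R) (pres_gen S R ` S) = carrier (presented_group S R)"
proof
  interpret group "presented_group S R" by (rule group_presented_group)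
  show "generate (presented_group S R) (pres_gen S R ` S) \<subseteq> carrier (presented_group S R)"
    using pres_gen_closed[of S R] by (intro generate_incl) auto
  have "eval_word (presented_group S R) (pres_gen S R) w \<in> generate (presented_group S R) (pres_gen S R ` S)"
    if "w \<in> words S" for w
    using that
  proof (induction w)
    case (Cons l w)
    then show ?case by (cases l) (auto intro!: generate.eng intro: generate.intros)
  qed (auto intro: generate.intros)
  then show "carrier (presented_group S R) \<subseteq> generate (presented_group S R) (pres_gen S R ` S)"
    by (auto simp: carrier_presented_group eval_word_pres_gen)
qed

lemma presented_group_relation:
  assumes "(l, r) \<in> R" "l \<in> words S" "r \<in> words S"
  shows "eval_word (presented_group S R) (pres_gen S R) l = eval_word (presented_group S R) (pres_gen S R) r"
  using pres_eq.relation[of "[]" S "[]" l r R] assms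
  by (simp add: eval_word_pres_gen pres_class_eq)


section \<open>The lower central series\<close>

text \<open>
  Any descending series \<open>L\<close> with \<open>[L k, H] \<subseteq> L (k + 1)\<close> lies above the lower central series. In
  particular a homomorphism into a group in which \<open>L c\<close> is trivial kills \<open>\<gamma>\<^bsub>c+1\<^esub>\<close>.
  The index is shifted by one since \<open>lower_central\<close> is counted from \<open>1\<close>.
\<close>

lemma (in group_hom) hom_lower_central:
  assumes L: "\<And>k. subgroup (L k) H" "L 0 = carrier H"
    and comm: "\<And>k u w. u \<in> L k \<Longrightarrow> w \<in> carrier H \<Longrightarrow>
      u \<otimes>\<^bsub>H\<^esub> w \<otimes>\<^bsub>H\<^esub> inv\<^bsub>H\<^esub> u \<otimes>\<^bsub>H\<^esub> inv\<^bsub>H\<^esub> w \<in> L (Suc k)"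
  shows "x \<in> lower_central G (Suc k) \<Longrightarrow> h x \<in> L k"
proof (induction k arbitrary: x)
  case 0
  then show ?case using L by simp
next
  case (Suc k)
  let ?N = "lower_central G (Suc k)"
  have N: "u \<in> carrier G" if "u \<in> ?N" for u
    using subgroup.mem_carrier[OF normal_imp_subgroup[OF G.normal_lower_central] that] .
  let ?C = "{u \<otimes> v \<otimes> inv u \<otimes> inv v | u v. u \<in> ?N \<and> v \<in> carrier G}"
  have C: "?C \<subseteq> carrier G" "\<And>z. z \<in> ?C \<Longrightarrow> h z \<in> L (Suc k)"
    using N Suc.IH comm by auto
  have "x \<in> generate G ?C"
    using Suc.prems by (simp add: commutator_subgroup_def)
  then show ?case
  proof (induction rule: generate.induct)
    case one
    then show ?case by (simp add: L subgroup.one_closed)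
  next
    case (inv z)
    then have "z \<in> carrier G" "h z \<in> L (Suc k)" using C by blast+
    then show ?case using subgroup.m_inv_closed[OF L(1)] by simp
  next
    case (eng u v)
    then have "u \<in> carrier G" "v \<in> carrier G"
      using G.generate_in_carrier[OF C(1)] by blast+
    with eng show ?case
      using subgroup.m_closed[OF L(1)] by simp
  next
    case (incl z)
    then show ?case by (rule C(2))
  qed
qed

text \<open>
  If \<open>b = a\<^bsup>m\<^sup>k\<^esup>\<close> lies in \<open>\<gamma>\<^bsub>k+1\<^esub>\<close>, then \<open>[b, t\<^sub>i] = b\<^bsup>1 - q\<^sub>i\<^esup>\<close> lies in \<open>\<gamma>\<^bsub>k+2\<^esub>\<close>. The order of \<open>b\<close>
  modulo \<open>\<gamma>\<^bsub>k+2\<^esub>\<close> thus divides all \<open>q\<^sub>i - 1\<close>, hence their greatest common divisor.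
\<close>

lemma (in group) pow_mem_lower_central:
  fixes q :: "'i \<Rightarrow> nat"
  assumes a: "a \<in> carrier G" and t: "\<And>i. i \<in> I \<Longrightarrow> t i \<in> carrier G"
    and conj: "\<And>i. i \<in> I \<Longrightarrow> t i \<otimes> a \<otimes> inv (t i) = a [^] q i"
    and q: "\<And>i. i \<in> I \<Longrightarrow> q i > 0"
  shows "a [^] ((GCD i\<in>I. q i - 1) ^ k) \<in> lower_central G (Suc k)"
proof (induction k)
  case 0
  then show ?case using a by simp
next
  case (Suc k)
  let ?m = "GCD i\<in>I. q i - 1" and ?N = "lower_central G (Suc (Suc k))"
  define b where "b = a [^] (?m ^ k)"
  have b: "b \<in> carrier G" "b \<in> lower_central G (Suc k)"
    using a Suc by (simp_all add: b_def)
  interpret N: normal ?N G by (rule normal_lower_central)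
  interpret Q: group "G Mod ?N" by (rule N.factorgroup_is_group)
  have Nb: "?N #> b \<in> carrier (G Mod ?N)"
    using b by (auto simp: carrier_FactGroup)
  have one_iff: "?N #> z = ?N \<longleftrightarrow> z \<in> ?N" if "z \<in> carrier G" for z
    using that coset_join1 coset_join2 N.subgroup_axioms by blast
  have pow_iff: "(?N #> b) [^]\<^bsub>G Mod ?N\<^esub> j = \<one>\<^bsub>G Mod ?N\<^esub> \<longleftrightarrow> b [^] j \<in> ?N" for j :: nat
    using b by (simp add: N.FactGroup_pow one_iff del: lower_central.simps)
  have "Q.ord (?N #> b) dvd ?m"
  proof (rule Gcd_greatest)
    fix d assume "d \<in> (\<lambda>i. q i - 1) ` I"
    then obtain i where i: "i \<in> I" and d: "d = q i - 1" by auto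
    have "t i \<otimes> b \<otimes> inv (t i) = b [^] q i"
      using conj_int_pow[OF t[OF i] a conj[OF i], of "int (?m ^ k)", unfolded int_pow_int] a
      by (simp add: b_def nat_pow_pow mult.commute)
    also have "\<dots> = b \<otimes> b [^] d"
      using q[OF i] b d nat_pow_Suc2[of b d] by simp
    finally have tb: "t i \<otimes> b \<otimes> inv (t i) = b \<otimes> b [^] d" .
    have "b \<otimes> t i \<otimes> inv b \<otimes> inv (t i) = b \<otimes> inv (t i \<otimes> b \<otimes> inv (t i))"
      using b t[OF i] by (simp add: inv_mult_group m_assoc)
    also have "\<dots> = b \<otimes> (inv (b [^] d) \<otimes> inv b)"
      unfolding tb using b by (simp add: inv_mult_group)
    also have "\<dots> = inv (b [^] d)"
    proof -
      have "b \<otimes> inv (b [^] d) = inv (b [^] d) \<otimes> b"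
        using int_pow_mult[OF b(1), of 1 "- int d"] int_pow_mult[OF b(1), of "- int d" 1] b
        by (simp add: int_pow_neg int_pow_int)
      then have "b \<otimes> (inv (b [^] d) \<otimes> inv b) = inv (b [^] d) \<otimes> b \<otimes> inv b"
        using b by (simp flip: m_assoc)
      then show ?thesis
        using b by (simp add: m_assoc)
    qed
    finally have "inv (b [^] d) \<in> ?N"
      using b t[OF i] unfolding lower_central.simps commutator_subgroup_def
      by (metis (mono_tags, lifting) generate.incl mem_Collect_eq)
    then have "b [^] d \<in> ?N"
      using N.m_inv_closed[of "inv (b [^] d)"] b by simp
    then show "Q.ord (?N #> b) dvd d"
      using pow_iff Q.pow_eq_id[OF Nb] by blast
  qed
  then have "b [^] ?m \<in> ?N"
    using pow_iff Q.pow_eq_id[OF Nb] by blast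
  then show ?case
    using a by (simp add: b_def nat_pow_pow mult.commute)
qed


section \<open>Cyclic-by-free-Abelian semidirect products\<close>

text \<open>
  The congruences \<open>q\<^sub>i \<equiv> 1\<close> modulo \<open>m\<close> serve twice: they make the \<open>q\<^sub>i\<close> prime to \<open>m\<^sup>c\<close>, so that \<open>\<int>\<^sup>r\<close>
  acts on \<open>\<int>\<^bsub>m\<^sup>c\<^esub>\<close> by automorphisms, and they make this action trivial modulo \<open>m\<close>.
\<close>

locale cyclic_semidirect =
  fixes r m c :: nat and q :: "nat \<Rightarrow> nat"
  assumes m: "m > 0" and c: "c \<ge> 1" and q: "\<And>i. i \<in> {1..r} \<Longrightarrow> [q i = 1] (mod m)"
begin

definition M :: nat where "M = m ^ c"
abbreviation "Z \<equiv> integer_mod_group M"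
definition F :: "(nat \<Rightarrow>\<^sub>0 int) monoid" where "F = free_Abelian_group {1..r}"
definition act where "act = power_action M r q"
definition P where "P = semidirect_product Z F act"

text \<open>The generator of \<open>\<int>\<^bsub>M\<^esub>\<close> is reduced modulo \<open>M\<close>, as \<open>1\<close> is not in the carrier when \<open>M = 1\<close>.\<close>

definition gen_x :: "int \<times> (nat \<Rightarrow>\<^sub>0 int)" where "gen_x = (1 mod int M, 0)"
definition gen_s :: "nat \<Rightarrow> int \<times> (nat \<Rightarrow>\<^sub>0 int)" where "gen_s i = (0, frag_of i)"

lemma M_pos: "M > 0"
  using m by (simp add: M_def)

lemma m_dvd_M: "int m dvd int M"
  using c by (simp add: M_def)

lemma coprime_q: "i \<in> {1..r} \<Longrightarrow> coprime (q i) M"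
  using q[of i] cong_imp_coprime[of 1 "q i" m] by (simp add: cong_sym M_def)

lemma carrier_Z: "x \<in> carrier Z \<longleftrightarrow> 0 \<le> x \<and> x < int M"
  using M_pos by (simp add: carrier_integer_mod_group)

lemma F_closed [simp]:
  "0 \<in> carrier F" "i \<in> {1..r} \<Longrightarrow> frag_of i \<in> carrier F"
  "v \<in> carrier F \<Longrightarrow> w \<in> carrier F \<Longrightarrow> v + w \<in> carrier F"
  "v \<in> carrier F \<Longrightarrow> w \<in> carrier F \<Longrightarrow> v - w \<in> carrier F"
  "v \<in> carrier F \<Longrightarrow> - v \<in> carrier F"
  using keys_add[of v w] keys_diff[of v w] by (auto simp: F_def)

lemma F_induct [consumes 1, case_names zero diff gen]:
  assumes "v \<in> carrier F" and "Q 0"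
    and "\<And>v w. v \<in> carrier F \<Longrightarrow> w \<in> carrier F \<Longrightarrow> Q v \<Longrightarrow> Q w \<Longrightarrow> Q (v - w)"
    and "\<And>i. i \<in> {1..r} \<Longrightarrow> Q (frag_of i)"
  shows "Q v"
  using assms by (intro free_Abelian_group_induct[of v "{1..r}" Q]) (simp_all add: F_def)

lemma group_hom_act: "group_hom F (AutoGroup Z) act"
  using power_action_hom[of M r q] M_pos coprime_q
  by (simp add: group_hom_def group_hom_axioms_def group.AutoGroup F_def act_def)

lemma carrier_P: "carrier P = carrier Z \<times> carrier F"
  by (simp add: semidirect_product_def P_def)

lemma mult_P: "(x, v) \<otimes>\<^bsub>P\<^esub> (x', v') = ((x + act v x') mod int M, v + v')"
  by (simp add: semidirect_product_def P_def F_def)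

lemma one_P: "\<one>\<^bsub>P\<^esub> = (0, 0)"
  by (simp add: semidirect_product_def P_def F_def)

sublocale P: group P
  unfolding P_def using group_hom_act
  by (intro group_semidirect_product)
    (simp_all add: group_hom_def group_hom_axioms_def)

lemma act_auto: "v \<in> carrier F \<Longrightarrow> act v \<in> auto Z"
  using group_hom.hom_closed[OF group_hom_act, of v] unfolding carrier_AutoGroup .

lemma act_closed: "v \<in> carrier F \<Longrightarrow> x \<in> carrier Z \<Longrightarrow> act v x \<in> carrier Z"
  by (rule auto_closed[OF act_auto])

lemma act_zero:
  assumes "x \<in> carrier Z"
  shows "act 0 x = x"
proof -
  have "act 0 = \<one>\<^bsub>AutoGroup Z\<^esub>"
    using group_hom.hom_one[OF group_hom_act] unfolding F_def one_free_Abelian_group .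
  then show ?thesis
    by (simp only: AutoGroup_one_apply[OF assms])
qed

lemma act_add:
  assumes "v \<in> carrier F" "w \<in> carrier F" "x \<in> carrier Z"
  shows "act (v + w) x = act v (act w x)"
proof -
  have "act (v + w) = act v \<otimes>\<^bsub>AutoGroup Z\<^esub> act w"
    using group_hom.hom_mult[OF group_hom_act assms(1,2)] unfolding F_def mult_free_Abelian_group .
  then show ?thesis
    by (simp only: AutoGroup_mult_apply[OF act_auto[OF assms(1)] act_auto[OF assms(2)] assms(3)])
qed

lemma act_frag_of:
  "i \<in> {1..r} \<Longrightarrow> x \<in> carrier Z \<Longrightarrow> act (frag_of i) x = (int (q i) * x) mod int M"
  using power_action_generator[of M r q i x, OF M_pos coprime_q]
  unfolding act_def pow_integer_mod_group .

text \<open>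
  An automorphism of a cyclic group multiplies by its value at \<open>1\<close>. The action modulo \<open>m\<close> is a
  homomorphism that is trivial on the generators \<open>s\<^sub>i\<close>, so this multiplier is \<open>1\<close> modulo \<open>m\<close>.
\<close>

lemma act_multiplier:
  assumes v: "v \<in> carrier F"
  shows "\<exists>u. [u = 1] (mod int m) \<and> (\<forall>x\<in>carrier Z. act v x = (x * u) mod int M)"
proof (cases "M = 1")
  case True
  then have "x \<in> carrier Z \<longleftrightarrow> x = 0" for x unfolding carrier_Z by auto
  then show ?thesis
    using act_closed[OF v] by (intro exI[of _ 1]) auto
next
  case False
  then have M: "M > 1" using M_pos by linarith
  have 1: "1 \<in> carrier Z" using M by (simp add: carrier_Z)
  have lin: "act w x = (x * act w 1) mod int M" if "w \<in> carrier F" "x \<in> carrier Z" for w x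
    using auto_integer_mod_group_apply[OF act_auto M] that by simp
  from v have "[act v 1 = 1] (mod int m)"
  proof (induction rule: F_induct)
    case zero
    show ?case using 1 by (simp add: act_zero)
  next
    case (diff v w)
    \<comment> \<open>Additivity is used for \<open>v = w + (v - w)\<close>, which avoids inverses of multipliers.\<close>
    have "act v 1 = act (w + (v - w)) 1" by simp
    also have "\<dots> = act w (act (v - w) 1)"
      using diff 1 by (intro act_add) auto
    also have "\<dots> = (act (v - w) 1 * act w 1) mod int M"
      using diff 1 by (intro lin act_closed) auto
    finally have "[act v 1 = act (v - w) 1 * act w 1] (mod int m)"
      using m_dvd_M by (simp add: cong_def mod_mod_cancel)
    also have "[act (v - w) 1 * act w 1 = act (v - w) 1 * 1] (mod int m)"
      using diff by (intro cong_mult) auto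
    finally show ?case
      using diff by (simp add: cong_def)
  next
    case (gen i)
    have "[int (q i) = 1] (mod int m)"
      using q[OF gen] by (metis cong_int_iff of_nat_1)
    then show ?case
      using gen 1 m_dvd_M by (simp add: act_frag_of cong_def mod_mod_cancel)
  qed
  then show ?thesis
    using lin[OF v] by blast
qed

text \<open>
  Each application of \<open>act v - 1\<close> contributes a factor \<open>m\<close>, until the exponent reaches \<open>c\<close>: the
  exponents are cut off there because elements are only known modulo \<open>m\<^sup>c\<close>.
\<close>

lemma act_cong:
  assumes v: "v \<in> carrier F" and x: "x \<in> carrier Z" "int m ^ min k c dvd x"
  shows "int m ^ min (Suc k) c dvd act v x - x"
proof -
  obtain u where u: "[u = 1] (mod int m)" "act v x = (x * u) mod int M"
    by (metis act_multiplier[OF v] x(1))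
  have "int m ^ min (Suc k) c dvd int m ^ min k c * int m"
    using le_imp_power_dvd[of "min (Suc k) c" "Suc (min k c)" "int m"] by (simp add: mult.commute)
  also have "\<dots> dvd x * (u - 1)"
    using x(2) u(1) by (intro mult_dvd_mono) (simp_all add: cong_iff_dvd_diff)
  finally have "int m ^ min (Suc k) c dvd x * u - x"
    by (simp add: algebra_simps)
  moreover have "int m ^ min (Suc k) c dvd int M"
    by (simp add: M_def le_imp_power_dvd)
  ultimately show ?thesis
    unfolding u(2) minus_mult_div_eq_mod[symmetric, of "x * u"]
    using dvd_diff[of "int m ^ min (Suc k) c" "x * u - x" "int M * (x * u div int M)"]
    by (simp add: algebra_simps)
qed

lemma act_0_right:
  assumes "v \<in> carrier F"
  shows "act v 0 = 0"
proof -
  obtain u where "\<forall>x\<in>carrier Z. act v x = (x * u) mod int M"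
    using act_multiplier[OF assms] by blast
  from bspec[OF this, of 0] show ?thesis by simp
qed

lemma gen_x_closed: "gen_x \<in> carrier P"
  using M_pos by (simp add: carrier_P carrier_Z gen_x_def)

lemma gen_s_closed: "i \<in> {1..r} \<Longrightarrow> gen_s i \<in> carrier P"
  by (simp add: carrier_P gen_s_def)

lemma gen_x_mult: "x \<in> carrier Z \<Longrightarrow> gen_x \<otimes>\<^bsub>P\<^esub> (x, v) = ((1 + x) mod int M, v)"
  by (simp add: gen_x_def mult_P act_zero mod_add_left_eq)

lemma gen_s_mult:
  "i \<in> {1..r} \<Longrightarrow> x \<in> carrier Z \<Longrightarrow> gen_s i \<otimes>\<^bsub>P\<^esub> (x, v) = ((int (q i) * x) mod int M, frag_of i + v)"
  by (simp add: gen_s_def mult_P act_frag_of)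

lemma gen_x_pow: "gen_x [^]\<^bsub>P\<^esub> k = (int k mod int M, 0)" for k :: nat
proof (induction k)
  case (Suc k)
  have "int k mod int M \<in> carrier Z" using M_pos by (simp add: carrier_Z)
  then show ?case
    unfolding P.nat_pow_Suc2[OF gen_x_closed] Suc by (simp add: gen_x_mult mod_add_right_eq)
qed (simp add: one_P)

lemma gen_s_comm:
  "i \<in> {1..r} \<Longrightarrow> j \<in> {1..r} \<Longrightarrow> gen_s i \<otimes>\<^bsub>P\<^esub> gen_s j = gen_s j \<otimes>\<^bsub>P\<^esub> gen_s i"
  by (simp add: gen_s_def mult_P act_0_right add.commute)

lemma gen_s_conj:
  assumes i: "i \<in> {1..r}"
  shows "gen_s i \<otimes>\<^bsub>P\<^esub> gen_x \<otimes>\<^bsub>P\<^esub> inv\<^bsub>P\<^esub> gen_s i = gen_x [^]\<^bsub>P\<^esub> q i"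
proof -
  have "1 mod int M \<in> carrier Z" using M_pos by (simp add: carrier_Z)
  then have "gen_s i \<otimes>\<^bsub>P\<^esub> gen_x = (int (q i) mod int M, frag_of i)"
    using gen_s_mult[OF i, of "1 mod int M" 0] by (simp add: gen_x_def mod_mult_right_eq)
  also have "\<dots> = gen_x [^]\<^bsub>P\<^esub> q i \<otimes>\<^bsub>P\<^esub> gen_s i"
    by (simp add: gen_x_pow gen_s_def mult_P act_0_right)
  finally show ?thesis
    using gen_s_closed[OF i] gen_x_closed by (simp add: P.m_assoc)
qed

text \<open>
  Every element has the form \<open>(x, v) = gen_x\<^sup>x (0, v)\<close>, and the \<open>(0, v)\<close> form a copy of \<open>\<int>\<^sup>r\<close>.
\<close>

lemma generate_P: "generate P (insert gen_x (gen_s ` {1..r})) = carrier P"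
proof
  let ?B = "insert gen_x (gen_s ` {1..r})"
  have B: "?B \<subseteq> carrier P" using gen_x_closed gen_s_closed by auto
  show "generate P ?B \<subseteq> carrier P" by (rule P.generate_incl[OF B])
  interpret K: subgroup "generate P ?B" P by (rule P.generate_is_subgroup[OF B])
  have s: "(0, v) \<in> generate P ?B" if "v \<in> carrier F" for v
    using that
  proof (induction rule: F_induct)
    case zero
    show ?case using K.one_closed by (simp add: one_P)
  next
    case (diff v w)
    have "inv\<^bsub>P\<^esub> (0, w) = (0, - w)"
      by (rule P.inv_equality) (use diff in \<open>simp_all add: mult_P one_P act_0_right carrier_P\<close>)
    then have "(0, v) \<otimes>\<^bsub>P\<^esub> inv\<^bsub>P\<^esub> (0, w) = (0, v - w)"
      using diff by (simp add: mult_P act_0_right)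
    moreover have "(0, v) \<otimes>\<^bsub>P\<^esub> inv\<^bsub>P\<^esub> (0, w) \<in> generate P ?B"
      using diff by (intro K.m_closed K.m_inv_closed)
    ultimately show ?case by simp
  next
    case (gen i)
    then have "gen_s i \<in> ?B" by simp
    then show ?case by (metis generate.incl gen_s_def)
  qed
  have x: "gen_x [^]\<^bsub>P\<^esub> k \<in> generate P ?B" for k :: nat
  proof (induction k)
    case 0
    show ?case unfolding P.nat_pow_0 by (rule K.one_closed)
  next
    case (Suc k)
    show ?case
      unfolding P.nat_pow_Suc by (rule K.m_closed[OF Suc generate.incl]) simp
  qed
  show "carrier P \<subseteq> generate P ?B"
  proof
    fix g assume "g \<in> carrier P"
    then obtain x v where g: "g = (x, v)" "x \<in> carrier Z" "v \<in> carrier F"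
      by (auto simp: carrier_P)
    then have "gen_x [^]\<^bsub>P\<^esub> nat x \<otimes>\<^bsub>P\<^esub> (0, v) = g"
      by (simp add: gen_x_pow mult_P act_0_right carrier_Z)
    then show "g \<in> generate P ?B"
      using K.m_closed[OF x s] g(3) by metis
  qed
qed

text \<open>
  The group \<open>P\<close> is presented by the relations of \<open>\<Gamma>\<^sub>n\<close> together with \<open>x\<^sup>M = 1\<close>. On the normal form the
  homomorphism must be \<open>(x, v) \<mapsto> A\<^sup>x \<pi> v\<close>, where \<open>\<pi>\<close> is the extension of \<open>T\<close> to \<open>\<int>\<^sup>r\<close> that exists because
  the \<open>T i\<close> generate a commutative subgroup.
\<close>

lemma P_universal:
  assumes "group Q" and A: "A \<in> carrier Q" "A [^]\<^bsub>Q\<^esub> M = \<one>\<^bsub>Q\<^esub>"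
    and T: "\<And>i. i \<in> {1..r} \<Longrightarrow> T i \<in> carrier Q"
    and comm: "\<And>i j. i \<in> {1..r} \<Longrightarrow> j \<in> {1..r} \<Longrightarrow> T i \<otimes>\<^bsub>Q\<^esub> T j = T j \<otimes>\<^bsub>Q\<^esub> T i"
    and conj: "\<And>i. i \<in> {1..r} \<Longrightarrow> T i \<otimes>\<^bsub>Q\<^esub> A \<otimes>\<^bsub>Q\<^esub> inv\<^bsub>Q\<^esub> T i = A [^]\<^bsub>Q\<^esub> q i"
  obtains \<psi> where "\<psi> \<in> hom P Q" "\<psi> gen_x = A" "\<And>i. i \<in> {1..r} \<Longrightarrow> \<psi> (gen_s i) = T i"
proof -
  interpret Q: group Q by (rule assms(1))
  let ?K = "generate Q (T ` {1..r})"
  have TQ: "T ` {1..r} \<subseteq> carrier Q" using T by auto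
  interpret K: comm_group "Q\<lparr>carrier := ?K\<rparr>"
    using comm by (intro Q.comm_group_generate[OF TQ]) blast
  have "T ` {1..r} \<subseteq> carrier (Q\<lparr>carrier := ?K\<rparr>)"
    by (auto intro: generate.incl)
  then obtain \<pi> where \<pi>: "\<pi> \<in> hom F (Q\<lparr>carrier := ?K\<rparr>)" "\<And>i. i \<in> {1..r} \<Longrightarrow> \<pi> (frag_of i) = T i"
    unfolding F_def by (rule K.free_Abelian_group_universal) blast
  have "\<pi> \<in> hom F Q"
    using \<pi>(1) Q.generate_in_carrier[OF TQ] by (auto simp: hom_def)
  then interpret \<pi>: group_hom F Q \<pi>
    using Q.is_group by (simp add: group_hom_def group_hom_axioms_def F_def)
  have \<pi>_add: "\<pi> (v + w) = \<pi> v \<otimes>\<^bsub>Q\<^esub> \<pi> w" if "v \<in> carrier F" "w \<in> carrier F" for v w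
    using \<pi>.hom_mult[OF that] by (simp add: F_def)
  have \<pi>_0: "\<pi> 0 = \<one>\<^bsub>Q\<^esub>"
    using \<pi>.hom_one by (simp add: F_def)
  have A_mod: "A [^]\<^bsub>Q\<^esub> (x mod int M) = A [^]\<^bsub>Q\<^esub> x" for x :: int
  proof -
    have "int (Q.ord A) dvd int M"
      using Q.pow_eq_id[OF A(1)] A(2) by simp
    then show ?thesis
      using Q.int_pow_eq[OF A(1)] by (meson dvd_minus_mod dvd_trans)
  qed
  define \<psi> where "\<psi> = (\<lambda>(x :: int, v). A [^]\<^bsub>Q\<^esub> x \<otimes>\<^bsub>Q\<^esub> \<pi> v)"
  have x: "\<psi> gen_x = A"
    using A by (simp add: \<psi>_def gen_x_def A_mod \<pi>_0)
  have s: "\<psi> (gen_s i) = T i" if "i \<in> {1..r}" for i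
    using that T by (simp add: \<psi>_def gen_s_def \<pi>(2))
  have "\<psi> \<in> hom P Q"
  proof (rule hom_if_mult_generators[OF P.is_group Q.is_group _ generate_P])
    show "insert gen_x (gen_s ` {1..r}) \<subseteq> carrier P"
      using gen_x_closed gen_s_closed by auto
    show "\<psi> \<in> carrier P \<rightarrow> carrier Q"
      using A by (auto simp: \<psi>_def carrier_P)
    show "\<psi> \<one>\<^bsub>P\<^esub> = \<one>\<^bsub>Q\<^esub>"
      by (simp add: \<psi>_def one_P \<pi>_0)
    fix b g assume b: "b \<in> insert gen_x (gen_s ` {1..r})" and "g \<in> carrier P"
    then obtain x v where g: "g = (x, v)" "x \<in> carrier Z" "v \<in> carrier F"
      by (auto simp: carrier_P)
    from b consider "b = gen_x" | i where "i \<in> {1..r}" "b = gen_s i" by auto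
    then show "\<psi> (b \<otimes>\<^bsub>P\<^esub> g) = \<psi> b \<otimes>\<^bsub>Q\<^esub> \<psi> g"
    proof cases
      case 1
      have "\<psi> (gen_x \<otimes>\<^bsub>P\<^esub> g) = A [^]\<^bsub>Q\<^esub> (1 + x) \<otimes>\<^bsub>Q\<^esub> \<pi> v"
        using g by (simp add: gen_x_mult \<psi>_def A_mod)
      also have "\<dots> = A \<otimes>\<^bsub>Q\<^esub> (A [^]\<^bsub>Q\<^esub> x \<otimes>\<^bsub>Q\<^esub> \<pi> v)"
        unfolding Q.int_pow_mult[OF A(1)] using A g by (simp add: Q.m_assoc)
      finally show ?thesis
        unfolding 1 x using g by (simp add: \<psi>_def)
    next
      case (2 i)
      have "T i \<otimes>\<^bsub>Q\<^esub> A [^]\<^bsub>Q\<^esub> x \<otimes>\<^bsub>Q\<^esub> inv\<^bsub>Q\<^esub> T i = A [^]\<^bsub>Q\<^esub> (int (q i) * x)"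
        using Q.conj_int_pow[OF T[OF 2(1)] A(1) conj[OF 2(1)], of x] A(1)
        by (simp add: Q.int_pow_pow flip: int_pow_int)
      then have "A [^]\<^bsub>Q\<^esub> (int (q i) * x) \<otimes>\<^bsub>Q\<^esub> T i = T i \<otimes>\<^bsub>Q\<^esub> A [^]\<^bsub>Q\<^esub> x"
        using T[OF 2(1)] A(1) by (metis Q.inv_solve_right' Q.int_pow_closed Q.m_closed)
      then have "A [^]\<^bsub>Q\<^esub> (int (q i) * x) \<otimes>\<^bsub>Q\<^esub> (T i \<otimes>\<^bsub>Q\<^esub> \<pi> v) = T i \<otimes>\<^bsub>Q\<^esub> (A [^]\<^bsub>Q\<^esub> x \<otimes>\<^bsub>Q\<^esub> \<pi> v)"
        using T[OF 2(1)] A(1) g(3) by (simp flip: Q.m_assoc)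
      moreover have "\<psi> (gen_s i \<otimes>\<^bsub>P\<^esub> g) = A [^]\<^bsub>Q\<^esub> (int (q i) * x) \<otimes>\<^bsub>Q\<^esub> (T i \<otimes>\<^bsub>Q\<^esub> \<pi> v)"
        unfolding g(1) gen_s_mult[OF 2(1) g(2)]
        using 2(1) g by (simp add: \<psi>_def A_mod \<pi>_add \<pi>(2))
      ultimately show ?thesis
        unfolding 2(2) s[OF 2(1)] by (simp add: \<psi>_def g)
    qed
  qed
  from that[OF this x s] show thesis .
qed

text \<open>
  The central series \<open>P \<ge> m\<int>\<^bsub>M\<^esub> \<ge> m\<^sup>2\<int>\<^bsub>M\<^esub> \<ge> \<dots>\<close>, which reaches the trivial group at \<open>k = c\<close> and stays
  there.
\<close>

definition central_term :: "nat \<Rightarrow> (int \<times> (nat \<Rightarrow>\<^sub>0 int)) set"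
  where "central_term k = {(x, v) \<in> carrier P. int m ^ min k c dvd x \<and> (k > 0 \<longrightarrow> v = 0)}"

lemma central_term_0: "central_term 0 = carrier P"
  by (auto simp: central_term_def)

lemma central_term_c: "central_term c = {\<one>\<^bsub>P\<^esub>}"
proof -
  have "x = 0" if "int m ^ c dvd x" "x \<in> carrier Z" for x
  proof -
    have "0 \<le> x" "x < int m ^ c"
      using that(2) carrier_Z[of x] by (simp_all add: M_def)
    then show ?thesis
      using zdvd_imp_le[OF that(1)] by linarith
  qed
  then show ?thesis
    using c P.one_closed by (auto simp: central_term_def one_P carrier_P)
qed

lemma subgroup_central_term: "subgroup (central_term k) P"
proof (cases "k = 0")
  case True
  then show ?thesis by (simp add: central_term_0 P.subgroup_self)
next
  case False
  let ?d = "int m ^ min k c"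
  have dM: "?d dvd int M" by (simp add: M_def le_imp_power_dvd)
  have mem: "g \<in> central_term k \<longleftrightarrow> (\<exists>x. g = (x, 0) \<and> x \<in> carrier Z \<and> ?d dvd x)" for g
    using False by (auto simp: central_term_def carrier_P)
  have mod: "x mod int M \<in> carrier Z" for x
    using M_pos by (simp add: carrier_Z)
  show ?thesis
  proof (rule P.subgroupI)
    show "central_term k \<subseteq> carrier P" by (auto simp: central_term_def)
    show "central_term k \<noteq> {}" using mem[of "(0, 0)"] by auto
    fix g assume "g \<in> central_term k"
    then obtain x where x: "g = (x, 0)" "x \<in> carrier Z" "?d dvd x" by (auto simp: mem)
    have "inv\<^bsub>P\<^esub> g = ((- x) mod int M, 0)"
      by (rule P.inv_equality) (use x mod in \<open>simp_all add: mult_P one_P act_zero carrier_P mod_simps\<close>)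
    then show "inv\<^bsub>P\<^esub> g \<in> central_term k"
      using x dM mod by (simp add: mem dvd_mod)
    fix h assume "h \<in> central_term k"
    then obtain z where "h = (z, 0)" "z \<in> carrier Z" "?d dvd z" by (auto simp: mem)
    with x show "g \<otimes>\<^bsub>P\<^esub> h \<in> central_term k"
      using dM mod by (simp add: mem mult_P act_zero dvd_mod)
  qed
qed

text \<open>
  Both \<open>g h\<close> and \<open>h g\<close> have second component \<open>v + w\<close>, so their quotient lies in \<open>\<int>\<^bsub>M\<^esub>\<close> and is the
  difference of their first components.
\<close>

lemma commutator_P:
  assumes "v \<in> carrier F" "w \<in> carrier F" "x \<in> carrier Z" "z \<in> carrier Z"
  shows "(x, v) \<otimes>\<^bsub>P\<^esub> (z, w) \<otimes>\<^bsub>P\<^esub> inv\<^bsub>P\<^esub> (x, v) \<otimes>\<^bsub>P\<^esub> inv\<^bsub>P\<^esub> (z, w) =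
    (((act v z - z) - (act w x - x)) mod int M, 0)"
    (is "_ = ?C")
proof -
  let ?g = "(x, v)" and ?h = "(z, w)"
  have gh: "?g \<in> carrier P" "?h \<in> carrier P" and C: "?C \<in> carrier P"
    using assms M_pos by (auto simp: carrier_P carrier_Z)
  have "(z + act w x) mod int M \<in> carrier Z"
    using M_pos by (simp add: carrier_Z)
  then have "?C \<otimes>\<^bsub>P\<^esub> (?h \<otimes>\<^bsub>P\<^esub> ?g) = ?g \<otimes>\<^bsub>P\<^esub> ?h"
    by (simp add: mult_P act_zero mod_simps add.commute)
  then have "?C = ?g \<otimes>\<^bsub>P\<^esub> ?h \<otimes>\<^bsub>P\<^esub> inv\<^bsub>P\<^esub> (?h \<otimes>\<^bsub>P\<^esub> ?g)"
    using gh C by (metis P.inv_solve_right P.m_closed)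
  then show ?thesis
    using gh by (simp add: P.inv_mult_group P.m_assoc)
qed

lemma commutator_central_term:
  assumes g: "g \<in> central_term k" and h: "h \<in> carrier P"
  shows "g \<otimes>\<^bsub>P\<^esub> h \<otimes>\<^bsub>P\<^esub> inv\<^bsub>P\<^esub> g \<otimes>\<^bsub>P\<^esub> inv\<^bsub>P\<^esub> h \<in> central_term (Suc k)"
proof -
  obtain x v where g': "g = (x, v)" "x \<in> carrier Z" "v \<in> carrier F"
      "int m ^ min k c dvd x" "k > 0 \<Longrightarrow> v = 0"
    using g by (auto simp: central_term_def carrier_P)
  obtain z w where h': "h = (z, w)" "z \<in> carrier Z" "w \<in> carrier F"
    using h by (auto simp: carrier_P)
  let ?d = "int m ^ min (Suc k) c"
  have "?d dvd act v z - z"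
  proof (cases "k = 0")
    case True
    then show ?thesis using act_cong[of v z 0] g' h' by simp
  next
    case False
    then show ?thesis using g' h' by (simp add: act_zero)
  qed
  moreover have "?d dvd act w x - x"
    using g' h' by (intro act_cong)
  moreover have "?d dvd int M"
    by (simp add: M_def le_imp_power_dvd)
  ultimately have "?d dvd ((act v z - z) - (act w x - x)) mod int M"
    by (simp only: dvd_mod dvd_diff)
  then show ?thesis
    unfolding g'(1) h'(1) commutator_P[OF g'(3) h'(3) g'(2) h'(2)]
    using M_pos by (simp add: central_term_def carrier_P carrier_Z)
qed

end


section \<open>The group \<open>\<Gamma>\<^sub>n\<close> and its nilpotent quotients\<close>

definition Gamma_gens :: "nat \<Rightarrow> gen set"
  where "Gamma_gens r = {Gen_a} \<union> Gen_t ` {1..r}"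

definition Gamma_rels :: "nat \<Rightarrow> (nat \<Rightarrow> nat) \<Rightarrow> (gen word \<times> gen word) set"
  where "Gamma_rels r q =
    {([(Gen_t i, True), (Gen_t j, True)], [(Gen_t j, True), (Gen_t i, True)]) | i j.
        i \<in> {1..r} \<and> j \<in> {1..r} \<and> i \<noteq> j} \<union>
    {([(Gen_t i, True), (Gen_a, True), (Gen_t i, False)], replicate (q i) (Gen_a, True)) | i.
        i \<in> {1..r}}"

definition Gamma_gen :: "nat \<Rightarrow> (nat \<Rightarrow> nat) \<Rightarrow> gen \<Rightarrow> gen word set"
  where "Gamma_gen r q = pres_gen (Gamma_gens r) (Gamma_rels r q)"

lemma Gamma_presented: "Gamma r p y = presented_group (Gamma_gens r) (Gamma_rels r (\<lambda>i. p i ^ y i))"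
  unfolding Gamma_def Gamma_gens_def Gamma_rels_def ..

context
  fixes r :: nat and q :: "nat \<Rightarrow> nat"
begin

private abbreviation (input) "\<Gamma> \<equiv> presented_group (Gamma_gens r) (Gamma_rels r q)"
private abbreviation (input) "a \<equiv> Gamma_gen r q Gen_a"
private abbreviation (input) "t i \<equiv> Gamma_gen r q (Gen_t i)"

lemma Gamma_gen_closed: "a \<in> carrier \<Gamma>" "i \<in> {1..r} \<Longrightarrow> t i \<in> carrier \<Gamma>"
  using pres_gen_closed[of "Gamma_gens r" "Gamma_rels r q"]
  by (auto simp: Gamma_gen_def Gamma_gens_def)

lemma generate_Gamma: "generate \<Gamma> (insert a (t ` {1..r})) = carrier \<Gamma>"
proof -
  have "insert a (t ` {1..r}) = pres_gen (Gamma_gens r) (Gamma_rels r q) ` Gamma_gens r"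
    by (simp add: Gamma_gens_def Gamma_gen_def image_image)
  then show ?thesis
    by (simp only: generate_pres_gen)
qed

lemma Gamma_comm:
  assumes "i \<in> {1..r}" "j \<in> {1..r}"
  shows "t i \<otimes>\<^bsub>\<Gamma>\<^esub> t j = t j \<otimes>\<^bsub>\<Gamma>\<^esub> t i"
proof (cases "i = j")
  case False
  interpret group \<Gamma> by (rule group_presented_group)
  have "([(Gen_t i, True), (Gen_t j, True)], [(Gen_t j, True), (Gen_t i, True)]) \<in> Gamma_rels r q"
    using assms False unfolding Gamma_rels_def by blast
  then have "eval_word \<Gamma> (Gamma_gen r q) [(Gen_t i, True), (Gen_t j, True)] =
      eval_word \<Gamma> (Gamma_gen r q) [(Gen_t j, True), (Gen_t i, True)]"
    unfolding Gamma_gen_def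
    by (rule presented_group_relation) (use assms in \<open>simp_all add: Gamma_gens_def\<close>)
  then show ?thesis
    using Gamma_gen_closed assms by simp
qed simp

lemma Gamma_conj:
  assumes i: "i \<in> {1..r}"
  shows "t i \<otimes>\<^bsub>\<Gamma>\<^esub> a \<otimes>\<^bsub>\<Gamma>\<^esub> inv\<^bsub>\<Gamma>\<^esub> t i = a [^]\<^bsub>\<Gamma>\<^esub> q i"
proof -
  interpret group \<Gamma> by (rule group_presented_group)
  have "([(Gen_t i, True), (Gen_a, True), (Gen_t i, False)], replicate (q i) (Gen_a, True)) \<in> Gamma_rels r q"
    using i unfolding Gamma_rels_def by blast
  then have "eval_word \<Gamma> (Gamma_gen r q) [(Gen_t i, True), (Gen_a, True), (Gen_t i, False)] =
      eval_word \<Gamma> (Gamma_gen r q) (replicate (q i) (Gen_a, True))"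
    unfolding Gamma_gen_def
    by (rule presented_group_relation) (use i in \<open>auto simp: Gamma_gens_def words_def\<close>)
  also have "\<dots> = a [^]\<^bsub>\<Gamma>\<^esub> q i"
    unfolding Gamma_gen_def
    by (rule eval_word_replicate[OF _ pres_gen_closed]) (simp add: Gamma_gens_def)
  finally show ?thesis
    using Gamma_gen_closed i by (simp add: m_assoc)
qed

lemma Gamma_universal:
  assumes "group G" and A: "A \<in> carrier G" and T: "\<And>i. i \<in> {1..r} \<Longrightarrow> T i \<in> carrier G"
    and comm: "\<And>i j. i \<in> {1..r} \<Longrightarrow> j \<in> {1..r} \<Longrightarrow> T i \<otimes>\<^bsub>G\<^esub> T j = T j \<otimes>\<^bsub>G\<^esub> T i"
    and conj: "\<And>i. i \<in> {1..r} \<Longrightarrow> T i \<otimes>\<^bsub>G\<^esub> A \<otimes>\<^bsub>G\<^esub> inv\<^bsub>G\<^esub> T i = A [^]\<^bsub>G\<^esub> q i"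
  obtains f where "f \<in> hom \<Gamma> G" "f a = A" "\<And>i. i \<in> {1..r} \<Longrightarrow> f (t i) = T i"
proof -
  interpret G: group G by (rule assms(1))
  define e where "e g = (case g of Gen_a \<Rightarrow> A | Gen_t i \<Rightarrow> T i)" for g
  have e: "e \<in> Gamma_gens r \<rightarrow> carrier G"
    using A T by (auto simp: Gamma_gens_def e_def)
  have "eval_word G e u = eval_word G e v" if "(u, v) \<in> Gamma_rels r q" for u v
  proof -
    from that consider
      i j where "i \<in> {1..r}" "j \<in> {1..r}" "u = [(Gen_t i, True), (Gen_t j, True)]"
        "v = [(Gen_t j, True), (Gen_t i, True)]"
      | i where "i \<in> {1..r}" "u = [(Gen_t i, True), (Gen_a, True), (Gen_t i, False)]"
        "v = replicate (q i) (Gen_a, True)"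
      unfolding Gamma_rels_def by blast
    then show ?thesis
    proof cases
      case (1 i j)
      then show ?thesis using T comm by (simp add: e_def)
    next
      case (2 i)
      have "eval_word G e v = A [^]\<^bsub>G\<^esub> q i"
        using G.eval_word_replicate[of Gen_a "Gamma_gens r" e "q i"] e
        by (simp add: 2(3) Gamma_gens_def e_def)
      moreover have "eval_word G e u = T i \<otimes>\<^bsub>G\<^esub> A \<otimes>\<^bsub>G\<^esub> inv\<^bsub>G\<^esub> T i"
        using T[OF 2(1)] A by (simp add: 2(2) e_def G.m_assoc)
      ultimately show ?thesis
        using conj[OF 2(1)] by simp
    qed
  qed
  then obtain f where f: "f \<in> hom \<Gamma> G" "\<And>g. g \<in> Gamma_gens r \<Longrightarrow> f (Gamma_gen r q g) = e g"
    using G.presented_group_universal[OF e, of "Gamma_rels r q"] unfolding Gamma_gen_def by blast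
  show thesis
    by (rule that[OF f(1)]) (simp_all add: f(2) Gamma_gens_def e_def)
qed

end

theorem theorem3p4:
  fixes n r m c :: nat and p y :: "nat \<Rightarrow> nat"
  assumes "n \<ge> 2"
    and "n = (\<Prod>i=1..r. p i ^ y i)"
    and "\<And>i. i \<in> {1..r} \<Longrightarrow> Factorial_Ring.prime (p i)"
    and "inj_on p {1..r}"
    and "\<And>i. i \<in> {1..r} \<Longrightarrow> y i > 0"
    and "m = (GCD i\<in>{1..r}. p i ^ y i - 1)"
    and "c \<ge> 1"
  shows "Gamma_nilp r p y c \<cong> G_nilp r p y m c"
proof -
  define q where "q = (\<lambda>i. p i ^ y i)"
  have q2: "q i \<ge> 2" if "i \<in> {1..r}" for i
    using prime_ge_2_nat[OF assms(3)[OF that]] assms(5)[OF that]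
      self_le_power[of "p i" "y i"] unfolding q_def by linarith
  have m: "m = (GCD i\<in>{1..r}. q i - 1)"
    by (simp only: assms(6) q_def)
  have "r \<noteq> 0"
    using assms(1,2) by (intro notI) simp
  then have one: "1 \<in> {1..r}" by simp
  have dvd: "m dvd q i - 1" if "i \<in> {1..r}" for i
    unfolding m using that by (intro Gcd_dvd) blast
  \<comment> \<open>Since \<open>n > 1\<close> there is at least one index, so \<open>m\<close> divides some positive \<open>q i - 1\<close>.\<close>
  have "m > 0"
    using dvd[OF one] q2[OF one] by (intro gr0I) simp
  moreover have "[q i = 1] (mod m)" if "i \<in> {1..r}" for i
    using dvd[OF that] q2[OF that] by (simp add: cong_altdef_nat)
  ultimately interpret S: cyclic_semidirect r m c q
    using assms(7) by unfold_locales
  have G_nilp: "G_nilp r p y m c = S.P"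
    by (simp only: G_nilp_def S.P_def S.F_def S.act_def S.M_def flip: q_def)

  let ?\<Gamma> = "presented_group (Gamma_gens r) (Gamma_rels r q)"
  let ?a = "Gamma_gen r q Gen_a" and ?t = "\<lambda>i. Gamma_gen r q (Gen_t i)"
  let ?N = "lower_central ?\<Gamma> (Suc c)"
  let ?Q = "?\<Gamma> Mod ?N" and ?\<nu> = "\<lambda>g. ?N #>\<^bsub>?\<Gamma>\<^esub> g"
  have \<Gamma>: "Gamma r p y = ?\<Gamma>"
    unfolding q_def by (rule Gamma_presented)
  interpret \<Gamma>: group ?\<Gamma> by (rule group_presented_group)
  interpret N: normal ?N ?\<Gamma> by (rule \<Gamma>.normal_lower_central)
  interpret Q: group ?Q by (rule N.factorgroup_is_group)
  interpret \<nu>: group_hom ?\<Gamma> ?Q ?\<nu>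
    by unfold_locales (rule N.r_coset_hom_Mod)
  note closed = Gamma_gen_closed[where r = r and q = q]

  obtain f where f: "f \<in> hom ?\<Gamma> S.P" "f ?a = S.gen_x" "\<And>i. i \<in> {1..r} \<Longrightarrow> f (?t i) = S.gen_s i"
    by (rule Gamma_universal[where r = r and q = q and T = S.gen_s, OF S.P.is_group S.gen_x_closed
          S.gen_s_closed S.gen_s_comm S.gen_s_conj]) blast+
  interpret f: group_hom ?\<Gamma> S.P f
    by unfold_locales (rule f(1))

  have "?N \<subseteq> kernel ?\<Gamma> S.P f"
  proof
    fix g assume g: "g \<in> ?N"
    have "f g \<in> S.central_term c"
      by (rule f.hom_lower_central[OF S.subgroup_central_term S.central_term_0
            S.commutator_central_term g])
    then show "g \<in> kernel ?\<Gamma> S.P f"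
      using N.mem_carrier[OF g] by (simp add: kernel_def S.central_term_c)
  qed
  moreover have "kernel ?\<Gamma> S.P f \<subseteq> ?N"
  proof
    have "?a [^]\<^bsub>?\<Gamma>\<^esub> (m ^ c) \<in> ?N"
      unfolding m
      by (rule \<Gamma>.pow_mem_lower_central[OF closed(1) closed(2) Gamma_conj]) (use q2 in force)+
    then have pow: "?\<nu> ?a [^]\<^bsub>?Q\<^esub> S.M = \<one>\<^bsub>?Q\<^esub>"
      unfolding N.FactGroup_pow[OF closed(1)] one_FactGroup S.M_def
      by (intro \<Gamma>.coset_join2 \<Gamma>.nat_pow_closed closed N.subgroup_axioms)
    have comm: "?\<nu> (?t i) \<otimes>\<^bsub>?Q\<^esub> ?\<nu> (?t j) = ?\<nu> (?t j) \<otimes>\<^bsub>?Q\<^esub> ?\<nu> (?t i)"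
      if "i \<in> {1..r}" "j \<in> {1..r}" for i j
      using Gamma_comm[OF that] closed(2) that by (metis \<nu>.hom_mult)
    have conj: "?\<nu> (?t i) \<otimes>\<^bsub>?Q\<^esub> ?\<nu> ?a \<otimes>\<^bsub>?Q\<^esub> inv\<^bsub>?Q\<^esub> ?\<nu> (?t i) = ?\<nu> ?a [^]\<^bsub>?Q\<^esub> q i"
      if "i \<in> {1..r}" for i
      using arg_cong[OF Gamma_conj[OF that, where q = q], of ?\<nu>] closed(1) closed(2)[OF that]
      unfolding N.FactGroup_pow[OF closed(1)]
      by (metis \<nu>.hom_mult \<nu>.hom_inv \<Gamma>.m_closed \<Gamma>.inv_closed)
    obtain \<psi> where \<psi>: "\<psi> \<in> hom S.P ?Q" "\<psi> S.gen_x = ?\<nu> ?a"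
        "\<And>i. i \<in> {1..r} \<Longrightarrow> \<psi> (S.gen_s i) = ?\<nu> (?t i)"
      by (rule S.P_universal[where T = "\<lambda>i. ?\<nu> (?t i)", OF Q.is_group \<nu>.hom_closed[OF closed(1)] pow
            \<nu>.hom_closed[OF closed(2)] comm conj]) blast+
    interpret \<psi>: group_hom S.P ?Q \<psi>
      by unfold_locales (rule \<psi>(1))
    have "group_hom ?\<Gamma> ?Q (\<psi> \<circ> f)"
      by (intro group_hom.intro group_hom_axioms.intro \<Gamma>.is_group Q.is_group hom_compose[OF f(1) \<psi>(1)])
    then have \<psi>f: "(\<psi> \<circ> f) g = ?\<nu> g" if "g \<in> generate ?\<Gamma> (insert ?a (?t ` {1..r}))" for g
      by (rule hom_eq_on_generate[OF _ \<nu>.group_hom_axioms _ _ that]) (use closed f \<psi> in auto)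
    fix g assume "g \<in> kernel ?\<Gamma> S.P f"
    then have g: "g \<in> carrier ?\<Gamma>" "f g = \<one>\<^bsub>S.P\<^esub>"
      by (simp_all add: kernel_def)
    then have "?\<nu> g = ?N"
      using \<psi>f[of g] \<psi>.hom_one unfolding generate_Gamma by (simp del: lower_central.simps)
    then show "g \<in> ?N"
      by (rule \<Gamma>.coset_join1[OF _ g(1) N.subgroup_axioms])
  qed
  ultimately have kernel: "kernel ?\<Gamma> S.P f = ?N" by (rule subset_antisym[rotated])

  have "generate S.P (insert S.gen_x (S.gen_s ` {1..r})) \<subseteq> f ` carrier ?\<Gamma>"
  proof (rule S.P.generate_subgroup_incl[OF _ f.img_is_subgroup])
    show "insert S.gen_x (S.gen_s ` {1..r}) \<subseteq> f ` carrier ?\<Gamma>"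
      using f(2,3) closed by (metis (no_types, lifting) image_eqI image_subsetI insert_subset)
  qed
  then have "f ` carrier ?\<Gamma> = carrier S.P"
    using f.hom_closed unfolding S.generate_P by blast
  from f.FactGroup_iso[OF this] show ?thesis
    unfolding Gamma_nilp_def G_nilp \<Gamma> kernel by simp
qed

end
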